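(* Let $G=(V,E)$ be a finite digraph and $p\geq2$ an integer. Then $G$ has a nowhere-zero $p$-flow if and only if the flow polynomial $f_G^p$ is not in the ideal $I_E^p$.
   Context: Let $x=(x_e:e\in E)$ be variables and $\mathbb{C}[x]$ the polynomial ring over $\mathbb{C}$. Define $I_E^p:=\mathrm{ideal}\{\sum_{i=0}^{p-1}x_e^i : e\in E\}$ and $f_G^p:=\prod_{v\in V}\sum_{i=0}^{p-1}\Big(\prod_{e\in\delta^-(v)}x_e\prod_{e\in\delta^+(v)}x_e^{p-1}\Big)^i$, where $\delta^-(v)$ ($\delta^+(v)$) is the set of arcs with head (tail) $v$. A nowhere-zero $p$-flow is a map $\phi:E\to\mathbb{Z}_p\setminus\{0\}$ (with $\mathbb{Z}_p$ the integers modulo $p$) such that $\sum_{e\in\delta^-(v)}\phi(e)-\sum_{e\in\delta^+(v)}\phi(e)=0$ in $\mathbb{Z}_p$ for all $v\in V$. *)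

theory Defs
  imports
    Complex_Main
    "HOL-Library.Poly_Mapping"
    "HOL-Algebra.Ideal"
    "HOL-Number_Theory.Residues"
    "Graph_Theory.Digraph"
begin

type_synonym 'e cpoly = "('e \<Rightarrow>\<^sub>0 nat) \<Rightarrow>\<^sub>0 complex"

definition X :: "'e \<Rightarrow> 'e cpoly" where
  "X e = Poly_Mapping.single (Poly_Mapping.single e 1) 1"

text \<open>The type \<^typ>\<open>'e cpoly\<close> has one variable for each element of \<^typ>\<open>'e\<close>.
  The ring \<open>\<complex>[x\<^sub>e : e \<in> E]\<close> is cut out by admitting only monomials supported in \<open>E\<close>.\<close>

definition polynomial_ring :: "'e set \<Rightarrow> 'e cpoly ring" where
  "polynomial_ring E =
    \<lparr>carrier = {f. \<forall>m \<in> Poly_Mapping.keys f. Poly_Mapping.keys m \<subseteq> E},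
     monoid.mult = (*), one = 1, zero = 0, add = (+)\<rparr>"

lemma polynomial_ring_carrier_add:
  assumes "f \<in> carrier (polynomial_ring E)" "g \<in> carrier (polynomial_ring E)"
  shows "f + g \<in> carrier (polynomial_ring E)"
  using assms Poly_Mapping.keys_add[of f g] by (fastforce simp: polynomial_ring_def)

lemma polynomial_ring_carrier_mult:
  assumes "f \<in> carrier (polynomial_ring E)" "g \<in> carrier (polynomial_ring E)"
  shows "f * g \<in> carrier (polynomial_ring E)"
proof -
  have "Poly_Mapping.keys m \<subseteq> E" if m: "m \<in> Poly_Mapping.keys (f * g)" for m
  proof -
    obtain a b where "m = a + b" "a \<in> Poly_Mapping.keys f" "b \<in> Poly_Mapping.keys g"
      using m Poly_Mapping.keys_mult[of f g] by blast
    with assms show ?thesis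
      using Poly_Mapping.keys_add[of a b] by (fastforce simp: polynomial_ring_def)
  qed
  then show ?thesis by (simp add: polynomial_ring_def)
qed

lemma polynomial_ring_carrier_0: "0 \<in> carrier (polynomial_ring E)"
  and polynomial_ring_carrier_1: "1 \<in> carrier (polynomial_ring E)"
  and polynomial_ring_carrier_X: "e \<in> E \<Longrightarrow> X e \<in> carrier (polynomial_ring E)"
  and polynomial_ring_carrier_uminus:
    "f \<in> carrier (polynomial_ring E) \<Longrightarrow> - f \<in> carrier (polynomial_ring E)"
  by (auto simp: polynomial_ring_def X_def)

lemma polynomial_ring_carrier_power:
  "f \<in> carrier (polynomial_ring E) \<Longrightarrow> f ^ n \<in> carrier (polynomial_ring E)"
  by (induction n) (auto intro: polynomial_ring_carrier_mult polynomial_ring_carrier_1)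

lemma polynomial_ring_carrier_sum:
  "(\<And>a. a \<in> A \<Longrightarrow> f a \<in> carrier (polynomial_ring E))
    \<Longrightarrow> sum f A \<in> carrier (polynomial_ring E)"
  by (induction A rule: infinite_finite_induct)
    (auto intro: polynomial_ring_carrier_add polynomial_ring_carrier_0)

lemma polynomial_ring_carrier_prod:
  "(\<And>a. a \<in> A \<Longrightarrow> f a \<in> carrier (polynomial_ring E))
    \<Longrightarrow> prod f A \<in> carrier (polynomial_ring E)"
  by (induction A rule: infinite_finite_induct)
    (auto intro: polynomial_ring_carrier_mult polynomial_ring_carrier_1)

lemma cring_polynomial_ring: "cring (polynomial_ring E)"
proof -
  let ?R = "polynomial_ring E"
  have ops: "monoid.mult ?R = (*)" "one ?R = 1" "zero ?R = 0" "add ?R = (+)"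
    by (simp_all add: polynomial_ring_def)
  have inv: "\<exists>g \<in> carrier ?R. f + g = 0" if "f \<in> carrier ?R" for f
    using polynomial_ring_carrier_uminus[OF that] by (intro bexI[of _ "- f"]) simp_all
  show ?thesis
  proof (rule cringI)
    show "abelian_group ?R"
      by (rule abelian_groupI)
        (simp_all add: ops inv polynomial_ring_carrier_add polynomial_ring_carrier_0 ac_simps)
    show "Group.comm_monoid ?R"
      by (rule comm_monoidI)
        (simp_all add: ops polynomial_ring_carrier_mult polynomial_ring_carrier_1 ac_simps)
  qed (simp add: ops distrib_right)
qed

definition flow_ideal :: "nat \<Rightarrow> 'e set \<Rightarrow> 'e cpoly set" where
  "flow_ideal p E = Idl\<^bsub>polynomial_ring E\<^esub> {\<Sum>i<p. X e ^ i | e. e \<in> E}"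

definition flow_polynomial :: "nat \<Rightarrow> ('v, 'e) pre_digraph \<Rightarrow> 'e cpoly" where
  "flow_polynomial p G =
    (\<Prod>v \<in> verts G. \<Sum>i<p.
      ((\<Prod>e \<in> in_arcs G v. X e) * (\<Prod>e \<in> out_arcs G v. X e ^ (p - 1))) ^ i)"

lemma flow_ideal_generators_carrier:
  "{\<Sum>i<p. X e ^ i | e. e \<in> E} \<subseteq> carrier (polynomial_ring E)"
  by (auto intro!: polynomial_ring_carrier_sum polynomial_ring_carrier_power
      polynomial_ring_carrier_X)

lemma ideal_flow_ideal: "ideal (flow_ideal p E) (polynomial_ring E)"
  unfolding flow_ideal_def
  by (intro ring.genideal_ideal flow_ideal_generators_carrier cring.axioms(1)
      cring_polynomial_ring)

lemma flow_polynomial_carrier: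
  "flow_polynomial p G \<in> carrier (polynomial_ring (arcs G))"
  unfolding flow_polynomial_def
  by (intro polynomial_ring_carrier_prod polynomial_ring_carrier_sum
      polynomial_ring_carrier_power polynomial_ring_carrier_mult polynomial_ring_carrier_X) auto

definition nowhere_zero_flow :: "nat \<Rightarrow> ('v, 'e) pre_digraph \<Rightarrow> ('e \<Rightarrow> int) \<Rightarrow> bool" where
  "nowhere_zero_flow p G \<phi> \<longleftrightarrow>
    (let Z = residue_ring (int p) in
      \<phi> \<in> arcs G \<rightarrow> carrier Z - {\<zero>\<^bsub>Z\<^esub>} \<and>
      (\<forall>v \<in> verts G.
        (\<Oplus>\<^bsub>Z\<^esub>e \<in> in_arcs G v. \<phi> e) \<ominus>\<^bsub>Z\<^esub> (\<Oplus>\<^bsub>Z\<^esub>e \<in> out_arcs G v. \<phi> e) = \<zero>\<^bsub>Z\<^esub>))"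

end

theory Submission
  imports Defs
begin

text \<open>Let \<open>z\<close> be a primitive \<open>p\<close>-th root of unity. At the point \<open>(z ^ k e)\<^sub>e\<close> the factor of the flow
  polynomial at \<open>v\<close> is a geometric sum over a \<open>p\<close>-th root of unity, so it vanishes unless \<open>k\<close> is
  conserved at \<open>v\<close>. Hence a nowhere-zero flow is a point of the grid of nontrivial \<open>p\<close>-th roots
  of unity at which the flow polynomial does not vanish, and it remains to see that the ideal
  consists of all polynomials vanishing on this grid. For the nontrivial inclusion, the polynomials
  \<open>L\<^sub>k(x) = (1/p) \<Sum>j<p. z\<^bsup>-kj\<^esup> x\<^bsup>j\<^esup>\<close> satisfy \<open>\<Sum>k<p. L\<^sub>k = 1\<close>, the generators are \<open>p L\<^sub>0(x\<^sub>e)\<close>, and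
  \<open>x L\<^sub>k = z\<^bsup>k\<^esup> L\<^sub>k\<close> modulo \<open>L\<^sub>0\<close>. Multiplying \<open>f\<close> by \<open>1 = \<Prod>e. \<Sum>k<p. L\<^sub>k(x\<^sub>e)\<close> and expanding thus
  gives, modulo the ideal, a linear combination whose coefficients are values of \<open>f\<close> on the grid.\<close>

section \<open>Evaluation of polynomials at complex points\<close>

definition const_poly :: "complex \<Rightarrow> 'e cpoly" where
  "const_poly c = Poly_Mapping.single 0 c"

definition monom_eval :: "('e \<Rightarrow> complex) \<Rightarrow> ('e \<Rightarrow>\<^sub>0 nat) \<Rightarrow> complex" where
  "monom_eval a m = (\<Prod>e\<in>Poly_Mapping.keys m. a e ^ Poly_Mapping.lookup m e)"

definition poly_eval :: "('e \<Rightarrow> complex) \<Rightarrow> 'e cpoly \<Rightarrow> complex" where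
  "poly_eval a f = (\<Sum>m\<in>Poly_Mapping.keys f. Poly_Mapping.lookup f m * monom_eval a m)"

lemma const_poly_add: "const_poly (c + d) = const_poly c + const_poly d"
  and const_poly_diff: "const_poly (c - d) = const_poly c - const_poly d"
  and const_poly_mult: "const_poly (c * d) = const_poly c * const_poly d"
  and const_poly_0 [simp]: "const_poly 0 = 0"
  and const_poly_1 [simp]: "const_poly 1 = 1"
  by (simp_all add: const_poly_def single_add single_diff mult_single)

lemma const_poly_sum: "const_poly (sum c A) = (\<Sum>i\<in>A. const_poly (c i))"
  by (induction A rule: infinite_finite_induct) (simp_all add: const_poly_add)

lemma const_poly_carrier: "const_poly c \<in> carrier (polynomial_ring E)"
  by (simp add: const_poly_def polynomial_ring_def)

lemma poly_mapping_eq_sum_single: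
  "f = (\<Sum>k\<in>Poly_Mapping.keys f. Poly_Mapping.single k (Poly_Mapping.lookup f k))"
  by (rule poly_mapping_eqI) (auto simp: lookup_sum lookup_single when_def in_keys_iff)

lemma X_power: "X e ^ n = Poly_Mapping.single (Poly_Mapping.single e n) 1"
proof (induction n)
  case (Suc n)
  then show ?case
    by (simp add: X_def mult_single flip: single_add)
qed simp

text \<open>Breaks a monomial into a constant and variables, so that a property closed under
  products passes from these to every monomial.\<close>

lemma single_eq_prod_X:
  "Poly_Mapping.single m c =
    const_poly c * (\<Prod>e\<in>Poly_Mapping.keys m. X e ^ Poly_Mapping.lookup m e)"
proof -
  have prod: "(\<Prod>e\<in>A. X e ^ k e) = Poly_Mapping.single (\<Sum>e\<in>A. Poly_Mapping.single e (k e)) 1"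
    if "finite A" for A and k :: "'a \<Rightarrow> nat"
    using that by (induction A rule: finite_induct) (simp_all add: X_power mult_single)
  show ?thesis
    by (simp add: prod const_poly_def mult_single flip: poly_mapping_eq_sum_single)
qed

text \<open>Exponents outside the support are 0 and contribute factors 1. Enlarging the index set
  lets monomials with different supports be compared over one common set.\<close>

lemma monom_eval_superset:
  assumes "finite A" "Poly_Mapping.keys m \<subseteq> A"
  shows "monom_eval a m = (\<Prod>e\<in>A. a e ^ Poly_Mapping.lookup m e)"
  unfolding monom_eval_def
  by (rule prod.mono_neutral_left) (use assms in \<open>auto simp: in_keys_iff\<close>)

lemma monom_eval_0 [simp]: "monom_eval a 0 = 1"
  by (simp add: monom_eval_def)

lemma monom_eval_add: "monom_eval a (m + n) = monom_eval a m * monom_eval a n"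
proof -
  let ?A = "Poly_Mapping.keys m \<union> Poly_Mapping.keys n"
  have "monom_eval a l = (\<Prod>e\<in>?A. a e ^ Poly_Mapping.lookup l e)" if "l \<in> {m, n, m + n}" for l
    using that Poly_Mapping.keys_add[of m n] by (intro monom_eval_superset) auto
  then show ?thesis
    by (simp add: lookup_add power_add prod.distrib)
qed

lemma poly_eval_superset:
  assumes "finite A" "Poly_Mapping.keys f \<subseteq> A"
  shows "poly_eval a f = (\<Sum>m\<in>A. Poly_Mapping.lookup f m * monom_eval a m)"
  unfolding poly_eval_def
  by (rule sum.mono_neutral_left) (use assms in \<open>auto simp: in_keys_iff\<close>)

lemma poly_eval_0 [simp]: "poly_eval a 0 = 0"
  by (simp add: poly_eval_def)

lemma poly_eval_single: "poly_eval a (Poly_Mapping.single m c) = c * monom_eval a m"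
  by (simp add: poly_eval_def)

lemma poly_eval_add: "poly_eval a (f + g) = poly_eval a f + poly_eval a g"
proof -
  let ?A = "Poly_Mapping.keys f \<union> Poly_Mapping.keys g"
  have "poly_eval a h = (\<Sum>m\<in>?A. Poly_Mapping.lookup h m * monom_eval a m)"
    if "h \<in> {f, g, f + g}" for h
    using that Poly_Mapping.keys_add[of f g] by (intro poly_eval_superset) auto
  then show ?thesis
    by (simp add: lookup_add distrib_right sum.distrib)
qed

lemma poly_eval_sum: "poly_eval a (sum f A) = (\<Sum>i\<in>A. poly_eval a (f i))"
  by (induction A rule: infinite_finite_induct) (simp_all add: poly_eval_add)

text \<open>Expanding both factors into monomials leaves only the multiplicativity of
  \<open>monom_eval\<close>.\<close>

lemma poly_eval_mult: "poly_eval a (f * g) = poly_eval a f * poly_eval a g"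
proof -
  let ?c = Poly_Mapping.lookup
  have "f * g = (\<Sum>m\<in>Poly_Mapping.keys f. Poly_Mapping.single m (?c f m)) *
      (\<Sum>n\<in>Poly_Mapping.keys g. Poly_Mapping.single n (?c g n))"
    by (simp flip: poly_mapping_eq_sum_single)
  also have "\<dots> = (\<Sum>m\<in>Poly_Mapping.keys f. \<Sum>n\<in>Poly_Mapping.keys g.
      Poly_Mapping.single (m + n) (?c f m * ?c g n))"
    by (simp add: sum_product mult_single)
  finally have "poly_eval a (f * g) = (\<Sum>m\<in>Poly_Mapping.keys f. \<Sum>n\<in>Poly_Mapping.keys g.
      (?c f m * monom_eval a m) * (?c g n * monom_eval a n))"
    by (simp add: poly_eval_sum poly_eval_single monom_eval_add mult_ac)
  then show ?thesis
    by (simp add: poly_eval_def sum_product)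
qed

lemma poly_eval_const [simp]: "poly_eval a (const_poly c) = c"
  by (simp add: const_poly_def poly_eval_single)

lemma poly_eval_1 [simp]: "poly_eval a 1 = 1"
  using poly_eval_const[of a 1] by simp

lemma poly_eval_X [simp]: "poly_eval a (X e) = a e"
  by (simp add: X_def poly_eval_single monom_eval_def)

lemma poly_eval_power: "poly_eval a (f ^ n) = poly_eval a f ^ n"
  by (induction n) (simp_all add: poly_eval_mult)

lemma poly_eval_prod: "poly_eval a (prod f A) = (\<Prod>i\<in>A. poly_eval a (f i))"
  by (induction A rule: infinite_finite_induct) (simp_all add: poly_eval_mult)

section \<open>The flow ideal and its zeros\<close>

lemma flow_ideal_add: "f \<in> flow_ideal p E \<Longrightarrow> g \<in> flow_ideal p E \<Longrightarrow> f + g \<in> flow_ideal p E"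
  using additive_subgroup.a_closed[OF ideal.axioms(1)[OF ideal_flow_ideal[of p E]]]
  by (simp add: polynomial_ring_def)

lemma flow_ideal_0: "0 \<in> flow_ideal p E"
  using additive_subgroup.zero_closed[OF ideal.axioms(1)[OF ideal_flow_ideal[of p E]]]
  by (simp add: polynomial_ring_def)

lemma flow_ideal_mult:
  "f \<in> flow_ideal p E \<Longrightarrow> g \<in> carrier (polynomial_ring E) \<Longrightarrow> g * f \<in> flow_ideal p E"
  using ideal.I_l_closed[OF ideal_flow_ideal[of p E], of f g]
  by (simp add: polynomial_ring_def)

lemma flow_ideal_sum: "(\<And>i. i \<in> A \<Longrightarrow> f i \<in> flow_ideal p E) \<Longrightarrow> sum f A \<in> flow_ideal p E"
  by (induction A rule: infinite_finite_induct) (auto intro: flow_ideal_add flow_ideal_0)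

lemma flow_ideal_generator: "e \<in> E \<Longrightarrow> (\<Sum>i<p. X e ^ i) \<in> flow_ideal p E"
  unfolding flow_ideal_def
  using ring.genideal_self[OF cring.axioms(1)[OF cring_polynomial_ring]
      flow_ideal_generators_carrier[of p E]] by blast

text \<open>The ring elements that vanish at \<open>a\<close> form an ideal \<open>?K\<close>
  containing the generators, so it contains the ideal they generate. This is the easy
  inclusion.\<close>

lemma poly_eval_flow_ideal:
  assumes f: "f \<in> flow_ideal p E" and a: "\<And>e. e \<in> E \<Longrightarrow> (\<Sum>i<p. a e ^ i) = 0"
  shows "poly_eval a f = 0"
proof -
  let ?R = "polynomial_ring E"
  let ?K = "{f \<in> carrier ?R. poly_eval a f = 0}"
  have ops: "monoid.mult ?R = (*)" "one ?R = 1" "zero ?R = 0" "add ?R = (+)"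
    by (simp_all add: polynomial_ring_def)
  interpret R: cring ?R
    by (rule cring_polynomial_ring)
  \<comment> \<open>Negation in the record \<open>?R\<close> is an abstract additive inverse;
    uniqueness of inverses identifies it with negation of polynomials.\<close>
  have inv: "\<ominus>\<^bsub>?R\<^esub> g = - g" if "g \<in> carrier ?R" for g
    using R.minus_equality[of "- g" g] that polynomial_ring_carrier_uminus[OF that]
    by (simp add: ops)
  have eval_uminus: "poly_eval a (- g) = - poly_eval a g" for g
    using poly_eval_add[of a g "- g"] by (simp add: eq_neg_iff_add_eq_0 add.commute)
  have "ideal ?K ?R"
  proof (rule idealI)
    show "subgroup ?K (add_monoid ?R)"
      by (rule R.add.subgroupI)
        (use inv in \<open>auto simp: ops poly_eval_add eval_uminus a_inv_def[symmetric]
            intro: polynomial_ring_carrier_0 polynomial_ring_carrier_add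
              polynomial_ring_carrier_uminus exI[of _ 0]\<close>)
  qed (auto simp: ops poly_eval_mult R.ring_axioms intro: polynomial_ring_carrier_mult)
  moreover have "{\<Sum>i<p. X e ^ i | e. e \<in> E} \<subseteq> ?K"
    using flow_ideal_generators_carrier[of p E] a
    by (auto simp: poly_eval_sum poly_eval_power)
  ultimately have "flow_ideal p E \<subseteq> ?K"
    unfolding flow_ideal_def by (rule R.genideal_minimal)
  with f show ?thesis by auto
qed

section \<open>Roots of unity\<close>

lemma sum_powers_root_unity:
  fixes y :: complex
  assumes "y ^ p = 1"
  shows "(\<Sum>i<p. y ^ i) = (if y = 1 then of_nat p else 0)"
  using assms geometric_sum[of y p] by auto

text \<open>The exponent may be reduced modulo \<open>p\<close>, and the first \<open>p\<close>
  powers are distinct. Primitivity in this form is all that the later argument uses about the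
  root.\<close>

lemma cis_power_eq_1_iff:
  assumes "p > 0"
  shows "cis (2 * pi / real p) ^ k = 1 \<longleftrightarrow> p dvd k"
proof -
  let ?z = "cis (2 * pi / real p)"
  have zp: "?z ^ p = 1"
    using assms by (simp add: DeMoivre)
  have "?z ^ k = ?z ^ (p * (k div p) + k mod p)"
    by simp
  also have "\<dots> = ?z ^ (k mod p)"
    unfolding power_add power_mult zp by simp
  finally have k: "?z ^ k = ?z ^ (k mod p)" .
  have inj: "inj_on (\<lambda>j. cis (2 * pi * real j / real p)) {..<p}"
    using bij_betw_roots_unity[OF assms] by (simp add: bij_betw_def)
  have "?z ^ (k mod p) = 1 \<longleftrightarrow> k mod p = 0"
  proof
    assume "?z ^ (k mod p) = 1"
    then have "cis (2 * pi * real (k mod p) / real p) = cis (2 * pi * real 0 / real p)"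
      by (simp add: DeMoivre mult_ac)
    then show "k mod p = 0"
      using assms by (intro inj_onD[OF inj]) auto
  qed simp
  with k show ?thesis
    by (simp add: dvd_eq_mod_eq_0)
qed

section \<open>Lagrange basis polynomials at the \<open>p\<close>-th roots of unity\<close>

definition root_idempotent :: "nat \<Rightarrow> complex \<Rightarrow> nat \<Rightarrow> 'e \<Rightarrow> 'e cpoly" where
  "root_idempotent p z k e =
    const_poly (1 / of_nat p) * (\<Sum>j<p. const_poly (inverse z ^ (k * j)) * X e ^ j)"

lemma root_idempotent_carrier:
  "e \<in> E \<Longrightarrow> root_idempotent p z k e \<in> carrier (polynomial_ring E)"
  unfolding root_idempotent_def
  by (intro polynomial_ring_carrier_mult polynomial_ring_carrier_sum const_poly_carrier
      polynomial_ring_carrier_power polynomial_ring_carrier_X)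

lemma root_idempotent_0_in_flow_ideal:
  "e \<in> E \<Longrightarrow> root_idempotent p z 0 e \<in> flow_ideal p E"
  unfolding root_idempotent_def
  by (intro flow_ideal_mult const_poly_carrier) (simp add: flow_ideal_generator)

text \<open>Orthogonality of characters: after exchanging the sums, the coefficient of
  \<open>X e ^ j\<close> is a geometric sum over the \<open>p\<close>-th root of unity
  \<open>inverse z ^ j\<close>, which is 1 only for \<open>j = 0\<close>.\<close>

lemma sum_root_idempotent:
  assumes p: "p > 0" and z: "\<And>k. z ^ k = 1 \<longleftrightarrow> p dvd k"
  shows "(\<Sum>k<p. root_idempotent p z k e) = 1"
proof -
  have inner: "(\<Sum>k<p. inverse z ^ (k * j)) = (if j = 0 then of_nat p else 0)" if "j < p" for j
  proof -
    have "(\<Sum>k<p. inverse z ^ (k * j)) = (\<Sum>k<p. (inverse z ^ j) ^ k)"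
      by (simp add: mult.commute flip: power_mult)
    also have "\<dots> = (if inverse z ^ j = 1 then of_nat p else 0)"
      by (rule sum_powers_root_unity)
        (simp add: z power_inverse flip: power_mult)
    also have "inverse z ^ j = 1 \<longleftrightarrow> j = 0"
      using that by (auto simp: power_inverse z dest: dvd_imp_le)
    finally show ?thesis .
  qed
  have "(\<Sum>k<p. root_idempotent p z k e) =
      const_poly (1 / of_nat p) * (\<Sum>k<p. \<Sum>j<p. const_poly (inverse z ^ (k * j)) * X e ^ j)"
    by (simp add: root_idempotent_def sum_distrib_left)
  also have "(\<Sum>k<p. \<Sum>j<p. const_poly (inverse z ^ (k * j)) * X e ^ j) =
      (\<Sum>j<p. const_poly (\<Sum>k<p. inverse z ^ (k * j)) * X e ^ j)"
    by (subst sum.swap) (simp add: const_poly_sum sum_distrib_right)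
  also have "\<dots> = (\<Sum>j<p. if j = 0 then const_poly (of_nat p) else 0)"
    by (rule sum.cong) (auto simp: inner)
  also have "const_poly (1 / of_nat p) * \<dots> = 1"
    using p by (simp flip: const_poly_mult)
  finally show ?thesis .
qed

text \<open>The product telescopes to a constant multiple of \<open>X e ^ p - 1\<close>, and this is
  \<open>X e - 1\<close> times a generator.\<close>

lemma X_mult_root_idempotent:
  assumes p: "p > 0" and z: "z ^ p = 1" and e: "e \<in> E"
  shows "(X e - const_poly (z ^ k)) * root_idempotent p z k e \<in> flow_ideal p E"
proof -
  \<comment> \<open>The extra factor \<open>z ^ k\<close> makes multiplication of the
    \<open>j\<close>-th term by \<open>X e\<close> and by \<open>z ^ k\<close> give the consecutive
    values \<open>?g (Suc j)\<close> and \<open>?g j\<close>.\<close>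
  let ?g = "\<lambda>j. const_poly (z ^ k * inverse z ^ (k * j)) * X e ^ j"
  have z0: "z \<noteq> 0"
    using z p by (auto simp: power_0_left)
  have step: "X e * (const_poly (inverse z ^ (k * j)) * X e ^ j) = ?g (Suc j)" for j
  proof -
    have "z ^ k * inverse z ^ (k * Suc j) = inverse z ^ (k * j)"
      using z0 by (simp add: power_add power_inverse)
    then show ?thesis
      by (simp only: power_Suc mult_ac)
  qed
  have zpk: "inverse z ^ (k * p) = 1"
    by (simp add: mult.commute[of k] power_mult power_inverse z)
  have "(X e - const_poly (z ^ k)) * (\<Sum>j<p. const_poly (inverse z ^ (k * j)) * X e ^ j) =
      (\<Sum>j<p. ?g (Suc j) - ?g j)"
    unfolding sum_distrib_left left_diff_distrib
    by (rule sum.cong) (simp_all only: step const_poly_mult mult.assoc)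
  also have "\<dots> = ?g p - ?g 0"
    by (rule sum_lessThan_telescope)
  also have "\<dots> = const_poly (z ^ k) * (X e ^ p - 1)"
    by (simp add: zpk right_diff_distrib)
  also have "X e ^ p - 1 = (X e - 1) * (\<Sum>j<p. X e ^ j)"
    by (rule power_diff_1_eq)
  finally have "(X e - const_poly (z ^ k)) * root_idempotent p z k e =
      (const_poly (1 / of_nat p) * const_poly (z ^ k) * (X e + const_poly (-1))) *
        (\<Sum>j<p. X e ^ j)"
    unfolding root_idempotent_def
    by (simp add: const_poly_diff[of 0 1, simplified] mult.left_commute mult.assoc)
  then show ?thesis
    using e by (simp only:) (intro flow_ideal_mult flow_ideal_generator polynomial_ring_carrier_mult
        polynomial_ring_carrier_add const_poly_carrier polynomial_ring_carrier_X)
qed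

text \<open>Modulo the ideal, \<open>h\<close> is a common eigenvector of the variables with
  eigenvalues \<open>a e\<close>. The polynomials acting on \<open>h\<close> as the scalar given by
  their value at \<open>a\<close> include constants and variables and are closed under sums and
  products.\<close>

lemma eigenvector_mod_flow_ideal:
  assumes f: "f \<in> carrier (polynomial_ring E)"
    and X: "\<And>e. e \<in> E \<Longrightarrow> (X e - const_poly (a e)) * h \<in> flow_ideal p E"
  shows "(f - const_poly (poly_eval a f)) * h \<in> flow_ideal p E"
proof -
  \<comment> \<open>Membership in the carrier is carried along because the product case multiplies
    an ideal element by \<open>g1\<close>.\<close>
  define P where "P g \<longleftrightarrow> g \<in> carrier (polynomial_ring E) \<and>
    (g - const_poly (poly_eval a g)) * h \<in> flow_ideal p E" for g
  have P_const: "P (const_poly c)" for c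
    by (simp add: P_def const_poly_carrier flow_ideal_0)
  have P_add: "P (g1 + g2)" if "P g1" "P g2" for g1 g2
    using that flow_ideal_add[of "(g1 - const_poly (poly_eval a g1)) * h" p E
        "(g2 - const_poly (poly_eval a g2)) * h"]
    by (simp add: P_def polynomial_ring_carrier_add poly_eval_add const_poly_add algebra_simps)
  have P_mult: "P (g1 * g2)" if "P g1" "P g2" for g1 g2
  proof -
    have "(g1 * g2 - const_poly (poly_eval a (g1 * g2))) * h =
        g1 * ((g2 - const_poly (poly_eval a g2)) * h) +
        const_poly (poly_eval a g2) * ((g1 - const_poly (poly_eval a g1)) * h)"
      by (simp add: poly_eval_mult const_poly_mult algebra_simps)
    then show ?thesis
      using that by (simp add: P_def polynomial_ring_carrier_mult flow_ideal_add flow_ideal_mult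
          const_poly_carrier)
  qed
  have P_power: "P (g ^ n)" if "P g" for g n
    using that P_const[of 1] by (induction n) (auto intro: P_mult)
  have P_prod: "P (prod g A)" if "\<And>i. i \<in> A \<Longrightarrow> P (g i)" for g and A :: "'a set"
    using that P_const[of 1] by (induction A rule: infinite_finite_induct) (auto intro: P_mult)
  have P_sum: "P (sum g A)" if "\<And>i. i \<in> A \<Longrightarrow> P (g i)" for g and A :: "('a \<Rightarrow>\<^sub>0 nat) set"
    using that P_const[of 0] by (induction A rule: infinite_finite_induct) (auto intro: P_add)
  have "P (X e)" if "e \<in> E" for e
    using that X by (simp add: P_def polynomial_ring_carrier_X)
  then have "P (Poly_Mapping.single m c)" if "Poly_Mapping.keys m \<subseteq> E" for m c
    unfolding single_eq_prod_X using that by (intro P_mult P_const P_prod P_power) auto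
  then have "P (\<Sum>m\<in>Poly_Mapping.keys f. Poly_Mapping.single m (Poly_Mapping.lookup f m))"
    using f by (intro P_sum) (simp add: polynomial_ring_def)
  then show ?thesis
    by (simp add: P_def flip: poly_mapping_eq_sum_single)
qed

lemma in_flow_ideal_if_vanishing:
  assumes E: "finite E" and f: "f \<in> carrier (polynomial_ring E)"
    and p: "p > 0" and z: "\<And>k. z ^ k = 1 \<longleftrightarrow> p dvd k"
    and vanish: "\<And>k. k \<in> E \<rightarrow> {1..<p} \<Longrightarrow> poly_eval (\<lambda>e. z ^ k e) f = 0"
  shows "f \<in> flow_ideal p E"
proof -
  let ?L = "\<lambda>k. \<Prod>e\<in>E. root_idempotent p z (k e) e"
  \<comment> \<open>It suffices to treat a single factor of the product, as the remaining ones are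
    ring elements and the ideal absorbs them.\<close>
  have L_mult: "g * ?L k \<in> flow_ideal p E"
    if "e \<in> E" "g * root_idempotent p z (k e) e \<in> flow_ideal p E" for g k e
  proof -
    have "g * ?L k =
        (\<Prod>e\<in>E - {e}. root_idempotent p z (k e) e) * (g * root_idempotent p z (k e) e)"
      using E that by (simp add: prod.remove mult_ac)
    then show ?thesis
      using that by (auto intro!: flow_ideal_mult polynomial_ring_carrier_prod
          root_idempotent_carrier)
  qed
  \<comment> \<open>Each extensional \<open>k\<close> is one choice of summands in the expansion of
    the product of sums. A value 0 selects a multiple of a generator; otherwise \<open>k\<close>
    names a grid point, where \<open>f\<close> vanishes.\<close>
  have "f * ?L k \<in> flow_ideal p E" if k: "k \<in> E \<rightarrow>\<^sub>E {..<p}" for k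
  proof (cases "\<exists>e\<in>E. k e = 0")
    case True
    then obtain e where e: "e \<in> E" "k e = 0" by blast
    show ?thesis
      using e by (intro L_mult[OF e(1)] flow_ideal_mult f)
        (simp add: root_idempotent_0_in_flow_ideal)
  next
    case False
    with k have "k \<in> E \<rightarrow> {1..<p}"
      by (auto simp: PiE_iff Suc_le_eq)
    moreover have "(f - const_poly (poly_eval (\<lambda>e. z ^ k e) f)) * ?L k \<in> flow_ideal p E"
    proof (rule eigenvector_mod_flow_ideal[OF f])
      fix e assume "e \<in> E"
      then show "(X e - const_poly (z ^ k e)) * ?L k \<in> flow_ideal p E"
        using X_mult_root_idempotent[OF p, of z] z[of p] by (intro L_mult) simp_all
    qed
    ultimately show ?thesis
      by (simp add: vanish)
  qed
  then have "(\<Sum>k\<in>E \<rightarrow>\<^sub>E {..<p}. f * ?L k) \<in> flow_ideal p E"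
    by (rule flow_ideal_sum)
  also have "(\<Sum>k\<in>E \<rightarrow>\<^sub>E {..<p}. f * ?L k) = f * (\<Prod>e\<in>E. \<Sum>k<p. root_idempotent p z k e)"
    using E by (simp add: prod_sum_PiE sum_distrib_left)
  also have "\<dots> = f"
    by (simp add: sum_root_idempotent[OF p z])
  finally show ?thesis .
qed

section \<open>Values of the flow polynomial and conservation of flow\<close>

lemma poly_eval_flow_polynomial_nonzero_iff:
  assumes G: "fin_digraph G" and p: "p > 0" and z: "\<And>k. z ^ k = 1 \<longleftrightarrow> p dvd k"
  shows "poly_eval (\<lambda>e. z ^ k e) (flow_polynomial p G) \<noteq> 0 \<longleftrightarrow>
    (\<forall>v\<in>verts G. [(\<Sum>e\<in>in_arcs G v. k e) = (\<Sum>e\<in>out_arcs G v. k e)] (mod p))"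
proof -
  interpret fin_digraph G by fact
  \<comment> \<open>Exponent of \<open>z\<close> in the base of the geometric sum at
    \<open>v\<close>. As \<open>p - 1\<close> is -1 modulo \<open>p\<close>, it represents inflow
    minus outflow.\<close>
  let ?n = "\<lambda>v. (\<Sum>e\<in>in_arcs G v. k e) + (p - 1) * (\<Sum>e\<in>out_arcs G v. k e)"
  have "poly_eval (\<lambda>e. z ^ k e) (flow_polynomial p G) = (\<Prod>v\<in>verts G. \<Sum>i<p. (z ^ ?n v) ^ i)"
    by (simp add: flow_polynomial_def poly_eval_prod poly_eval_sum poly_eval_power poly_eval_mult
        power_add power_sum sum_distrib_left mult.commute flip: power_mult)
  also have "\<dots> = (\<Prod>v\<in>verts G. if z ^ ?n v = 1 then of_nat p else 0)"
    by (intro prod.cong refl sum_powers_root_unity) (simp add: z flip: power_mult)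
  finally have eval_iff: "poly_eval (\<lambda>e. z ^ k e) (flow_polynomial p G) \<noteq> 0 \<longleftrightarrow>
      (\<forall>v\<in>verts G. p dvd ?n v)"
    using p by (auto simp: z)
  \<comment> \<open>The integers are used because the difference \<open>a - b\<close> may be
    negative.\<close>
  have dvd_iff: "p dvd a + (p - 1) * b \<longleftrightarrow> [a = b] (mod p)" for a b
  proof -
    have "p dvd a + (p - 1) * b \<longleftrightarrow> int p dvd int a + (int p - 1) * int b"
      using p by (simp add: of_nat_diff flip: int_dvd_int_iff)
    also have "int a + (int p - 1) * int b = (int a - int b) + int p * int b"
      by (simp add: algebra_simps)
    also have "int p dvd \<dots> \<longleftrightarrow> [int a = int b] (mod int p)"
      by (subst dvd_add_left_iff) (simp_all add: cong_iff_dvd_diff)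
    finally show ?thesis
      by (simp add: cong_int_iff)
  qed
  show ?thesis
    unfolding eval_iff dvd_iff ..
qed

text \<open>Values in \<open>{1..<p}\<close> are the canonical nonzero residues, so sums in the
  residue ring are ordinary sums reduced modulo \<open>p\<close>.\<close>

lemma nowhere_zero_flow_int:
  assumes G: "fin_digraph G" and p: "p \<ge> 2" and k: "k \<in> arcs G \<rightarrow> {1..<p}"
  shows "nowhere_zero_flow p G (\<lambda>e. int (k e)) \<longleftrightarrow>
    (\<forall>v\<in>verts G. [(\<Sum>e\<in>in_arcs G v. k e) = (\<Sum>e\<in>out_arcs G v. k e)] (mod p))"
proof -
  interpret fin_digraph G by fact
  interpret residues "int p" "residue_ring (int p)"
    using p by unfold_locales simp_all
  let ?Z = "residue_ring (int p)"
  have carr: "int (k e) \<in> carrier ?Z" if "e \<in> arcs G" for e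
    using k that by (force simp: residue_ring_def)
  have finsum_eq: "(\<Oplus>\<^bsub>?Z\<^esub>e\<in>A. int (k e)) = int (\<Sum>e\<in>A. k e) mod int p"
    if "finite A" "A \<subseteq> arcs G" for A
  proof -
    \<comment> \<open>Inserting this harmless reduction puts the ring sum into the form required by
      \<open>sum_cong\<close>.\<close>
    have "int (k e) mod int p = int (k e)" if "e \<in> A" for e
      using that \<open>A \<subseteq> arcs G\<close> k by (intro mod_pos_pos_trivial) auto
    then have "(\<Oplus>\<^bsub>?Z\<^esub>e\<in>A. int (k e)) = (\<Oplus>\<^bsub>?Z\<^esub>e\<in>A. int (k e) mod int p)"
      using that carr by (intro finsum_cong') auto
    with that show ?thesis
      by (simp add: sum_cong)
  qed
  have minus: "x \<ominus>\<^bsub>?Z\<^esub> y = \<zero>\<^bsub>?Z\<^esub> \<longleftrightarrow> x = y" if "x \<in> carrier ?Z" "y \<in> carrier ?Z" for x y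
    using that r_right_minus_eq by blast
  have "(\<Oplus>\<^bsub>?Z\<^esub>e\<in>in_arcs G v. int (k e)) \<ominus>\<^bsub>?Z\<^esub> (\<Oplus>\<^bsub>?Z\<^esub>e\<in>out_arcs G v. int (k e)) = \<zero>\<^bsub>?Z\<^esub> \<longleftrightarrow>
      [(\<Sum>e\<in>in_arcs G v. k e) = (\<Sum>e\<in>out_arcs G v. k e)] (mod p)" for v
  proof -
    have "(\<Oplus>\<^bsub>?Z\<^esub>e\<in>in_arcs G v. int (k e)) \<ominus>\<^bsub>?Z\<^esub> (\<Oplus>\<^bsub>?Z\<^esub>e\<in>out_arcs G v. int (k e)) = \<zero>\<^bsub>?Z\<^esub> \<longleftrightarrow>
        (\<Oplus>\<^bsub>?Z\<^esub>e\<in>in_arcs G v. int (k e)) = (\<Oplus>\<^bsub>?Z\<^esub>e\<in>out_arcs G v. int (k e))"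
      using carr by (intro minus finsum_closed) auto
    also have "\<dots> \<longleftrightarrow> [int (\<Sum>e\<in>in_arcs G v. k e) = int (\<Sum>e\<in>out_arcs G v. k e)] (mod int p)"
      by (subst (1 2) finsum_eq) (auto simp: cong_def)
    finally show ?thesis
      by (simp only: cong_int_iff)
  qed
  moreover have "(\<lambda>e. int (k e)) \<in> arcs G \<rightarrow> carrier ?Z - {\<zero>\<^bsub>?Z\<^esub>}"
    using k by (force simp: residue_ring_def)
  ultimately show ?thesis
    by (simp add: nowhere_zero_flow_def Let_def)
qed

text \<open>Supplies natural-number exponents for \<open>z\<close>. Off the arcs a flow is
  arbitrary, possibly negative, so \<open>int (nat (\<phi> e))\<close> need agree with
  \<open>\<phi> e\<close> only on arcs; the ring sums see nothing else.\<close>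

lemma ex_nowhere_zero_flow_iff:
  assumes G: "fin_digraph G" and p: "p \<ge> 2"
  shows "(\<exists>\<phi>. nowhere_zero_flow p G \<phi>) \<longleftrightarrow>
    (\<exists>k\<in>arcs G \<rightarrow> {1..<p}. nowhere_zero_flow p G (\<lambda>e. int (k e)))"
proof
  assume "\<exists>\<phi>. nowhere_zero_flow p G \<phi>"
  then obtain \<phi> where \<phi>: "nowhere_zero_flow p G \<phi>" ..
  let ?Z = "residue_ring (int p)"
  interpret residues "int p" ?Z
    using p by unfold_locales simp_all
  have range: "0 < \<phi> e \<and> \<phi> e < int p" if "e \<in> arcs G" for e
    using \<phi> that by (force simp: nowhere_zero_flow_def Let_def residue_ring_def)
  have carr: "\<phi> e \<in> carrier ?Z" if "e \<in> arcs G" for e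
    using range[OF that] by (simp add: residue_ring_def)
  have "(\<Oplus>\<^bsub>?Z\<^esub>e\<in>A. int (nat (\<phi> e))) = (\<Oplus>\<^bsub>?Z\<^esub>e\<in>A. \<phi> e)" if "A \<subseteq> arcs G" for A
    using that range carr by (intro finsum_cong') (auto simp: subset_iff less_imp_le)
  then have "nowhere_zero_flow p G (\<lambda>e. int (nat (\<phi> e)))"
    using \<phi> range by (auto simp: nowhere_zero_flow_def Let_def Pi_iff less_imp_le subset_iff)
  moreover have "(\<lambda>e. nat (\<phi> e)) \<in> arcs G \<rightarrow> {1..<p}"
    using range by fastforce
  ultimately show "\<exists>k\<in>arcs G \<rightarrow> {1..<p}. nowhere_zero_flow p G (\<lambda>e. int (k e))"
    by (rule bexI[where x = "\<lambda>e. nat (\<phi> e)"])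
qed blast

theorem theorem2p1:
  fixes G :: "('v, 'e) pre_digraph" and p :: nat
  assumes "fin_digraph G" and "p \<ge> 2"
  shows "(\<exists>\<phi>. nowhere_zero_flow p G \<phi>) \<longleftrightarrow> flow_polynomial p G \<notin> flow_ideal p (arcs G)"
proof -
  define z where "z = cis (2 * pi / real p)"
  have p: "p > 0"
    using assms by simp
  have z: "z ^ k = 1 \<longleftrightarrow> p dvd k" for k
    unfolding z_def by (rule cis_power_eq_1_iff[OF p])
  have "(\<exists>\<phi>. nowhere_zero_flow p G \<phi>) \<longleftrightarrow>
      (\<exists>k\<in>arcs G \<rightarrow> {1..<p}. poly_eval (\<lambda>e. z ^ k e) (flow_polynomial p G) \<noteq> 0)"
    using nowhere_zero_flow_int[OF assms] poly_eval_flow_polynomial_nonzero_iff[OF assms(1) p z]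
    by (auto simp: ex_nowhere_zero_flow_iff[OF assms])
  also have "\<dots> \<longleftrightarrow> flow_polynomial p G \<notin> flow_ideal p (arcs G)"
  proof
    assume "\<exists>k\<in>arcs G \<rightarrow> {1..<p}. poly_eval (\<lambda>e. z ^ k e) (flow_polynomial p G) \<noteq> 0"
    then obtain k where k: "k \<in> arcs G \<rightarrow> {1..<p}"
      and nz: "poly_eval (\<lambda>e. z ^ k e) (flow_polynomial p G) \<noteq> 0" ..
    \<comment> \<open>Since \<open>0 < k e < p\<close>, the power \<open>z ^ k e\<close> is a
      nontrivial \<open>p\<close>-th root of unity. All generators therefore vanish at this point,
      while the flow polynomial does not.\<close>
    have "(\<Sum>i<p. (z ^ k e) ^ i) = 0" if "e \<in> arcs G" for e
    proof -
      have "z ^ k e \<noteq> 1"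
        using k that by (force simp: z dest: dvd_imp_le)
      then show ?thesis
        by (subst sum_powers_root_unity) (simp_all add: z flip: power_mult)
    qed
    with nz show "flow_polynomial p G \<notin> flow_ideal p (arcs G)"
      using poly_eval_flow_ideal[where a = "\<lambda>e. z ^ k e"] by blast
  next
    \<comment> \<open>Contrapositive of the interpolation result: vanishing on the whole grid would
      force membership in the ideal.\<close>
    assume "flow_polynomial p G \<notin> flow_ideal p (arcs G)"
    then show "\<exists>k\<in>arcs G \<rightarrow> {1..<p}. poly_eval (\<lambda>e. z ^ k e) (flow_polynomial p G) \<noteq> 0"
      using in_flow_ideal_if_vanishing[OF fin_digraph.finite_arcs[OF assms(1)]
          flow_polynomial_carrier p z] by blast
  qed
  finally show ?thesis .
qed

end
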